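(* Let $m\ge 2$ and let $\mathbf A$ be an algebra belonging to an $m$-permutable variety. Let $R_0,\dots,R_m$ be arbitrary binary relations on (the universe of) $\mathbf A$, and let $S_1,\dots,S_m,T_1,\dots,T_m$ be reflexive binary relations on $\mathbf A$. Define $$R'_i=\overline{R_{i-1}\cup R_i\cup R_{i+1}}\quad (i=1,\dots,m-1),$$ $$S'_1=\overline{S_2},\qquad T'_1=\overline{T_2},\qquad S'_m=\overline{S_{m-1}},\qquad T'_m=\overline{T_{m-1}},$$ $$S'_i=\overline{S_{i-1}}\circ\overline{S_{i+1}},\qquad T'_i=\overline{T_{i+1}}\circ\overline{T_{i-1}}\quad (i=2,\dots,m-1).$$ Then $$R_{0} ( S_{1} \circ R_{1} ( S_{2} \circ R_{2} ( S_{3} \circ \dots R_{m-2} ( S_{m-1} \circ R_{m-1} ( S_{m} \circ R_{m} \circ T_{m} ) \circ T_{m-1} ) \dots \circ T_{3} )\circ T_{2}) \circ T_{1} )$$ $$\subseteq\; R_{0} ( S'_{1} \circ R'_{1} ( S'_{2} \circ R'_{2} ( S'_{3} \circ \dots R'_{m-2} ( S'_{m-1} \circ R'_{m-1} ( S'_{m} \circ R_{m} \circ T'_{m} ) \circ T'_{m-1} ) \ldots \circ T'_{3} )\circ T'_{2}) \circ T'_{1} ).$$ Explicitly: let $L_m=R_m$ and $L_i=R_i\cap(S_{i+1}\circ L_{i+1}\circ T_{i+1})$ for $i=m-1,\dots,0$; let $L'_m=R_m$, $L'_i=R'_i\cap(S'_{i+1}\circ L'_{i+1}\circ T'_{i+1})$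 for $i=m-1,\dots,1$, and $L'_0=R_0\cap(S'_1\circ L'_1\circ T'_1)$. Then $L_0\subseteq L'_0$.
   Context: Juxtaposition of relations denotes intersection (so $R(\cdots)=R\cap(\cdots)$), and $\circ$ denotes relational product: $a\,(R\circ S)\,b$ iff there is $c$ with $a\,R\,c$ and $c\,S\,b$. For a binary relation $X$ on $\mathbf A$, $\overline X$ denotes the least compatible relation containing $X$, where a binary relation is compatible if it is preserved by all basic operations of $\mathbf A$ (i.e. it is a subalgebra of $\mathbf A^2$). For congruences $\alpha,\beta$, $\alpha\circ_n\beta$ denotes $\alpha\circ\beta\circ\alpha\circ\beta\circ\cdots$ with $n-1$ occurrences of $\circ$ (i.e. $n$ factors). Two congruences $\alpha,\beta$ $m$-permute if $\alpha\circ_m\beta=\beta\circ_m\alpha$. An algebra is $m$-permutable if every pair of its congruences $m$-permute, and a variety (equational class of algebras) is $m$-permutable if every algebra in it is $m$-permutable. *)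

theory Defs
  imports "HOL-Library.Countable_Set"
begin

section \<open>Algebras, congruences and compatible relations\<close>

text \<open>
  A similarity type is a function \<open>ar\<close> that assigns to each operation symbol of type \<open>'f\<close> its
  (finite) arity. The interpretation of a symbol is only meaningful on lists of the right length
  with entries in the universe. Empty universes are not excluded.
\<close>

record ('f, 'a) algebra =
  universe :: "'a set"
  oper :: "'f \<Rightarrow> 'a list \<Rightarrow> 'a"

definition is_algebra :: "('f \<Rightarrow> nat) \<Rightarrow> ('f, 'a) algebra \<Rightarrow> bool" where
  "is_algebra ar A \<longleftrightarrow>
     (\<forall>f xs. length xs = ar f \<longrightarrow> set xs \<subseteq> universe A \<longrightarrow> oper A f xs \<in> universe A)"

definition relation_on :: "('f, 'a) algebra \<Rightarrow> 'a rel \<Rightarrow> bool" where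
  "relation_on A X \<longleftrightarrow> X \<subseteq> universe A \<times> universe A"

definition reflexive_on :: "('f, 'a) algebra \<Rightarrow> 'a rel \<Rightarrow> bool" where
  "reflexive_on A X \<longleftrightarrow> relation_on A X \<and> refl_on (universe A) X"

definition compatible :: "('f \<Rightarrow> nat) \<Rightarrow> ('f, 'a) algebra \<Rightarrow> 'a rel \<Rightarrow> bool" where
  "compatible ar A X \<longleftrightarrow> relation_on A X \<and>
     (\<forall>f xs ys. length xs = ar f \<longrightarrow> length ys = ar f \<longrightarrow> (\<forall>i<ar f. (xs ! i, ys ! i) \<in> X) \<longrightarrow>
        (oper A f xs, oper A f ys) \<in> X)"

definition compat_closure :: "('f \<Rightarrow> nat) \<Rightarrow> ('f, 'a) algebra \<Rightarrow> 'a rel \<Rightarrow> 'a rel" where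
  "compat_closure ar A X = \<Inter>{Y. compatible ar A Y \<and> X \<subseteq> Y}"

definition congruence :: "('f \<Rightarrow> nat) \<Rightarrow> ('f, 'a) algebra \<Rightarrow> 'a rel \<Rightarrow> bool" where
  "congruence ar A \<theta> \<longleftrightarrow> equiv (universe A) \<theta> \<and> compatible ar A \<theta>"

lemma compat_closure_least:
  assumes "is_algebra ar A" and "relation_on A X"
  shows "compatible ar A (compat_closure ar A X)"
    and "X \<subseteq> compat_closure ar A X"
    and "\<And>Y. compatible ar A Y \<Longrightarrow> X \<subseteq> Y \<Longrightarrow> compat_closure ar A X \<subseteq> Y"
proof -
  have "compatible ar A (universe A \<times> universe A)"
    using assms(1) unfolding compatible_def is_algebra_def relation_on_def
    by (auto simp: in_set_conv_nth subset_iff)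
  moreover have "X \<subseteq> universe A \<times> universe A"
    using assms(2) by (simp add: relation_on_def)
  ultimately have "compat_closure ar A X \<subseteq> universe A \<times> universe A"
    unfolding compat_closure_def by blast
  then show "compatible ar A (compat_closure ar A X)"
    unfolding compatible_def relation_on_def compat_closure_def by simp
qed (auto simp: compat_closure_def)

section \<open>Permutability\<close>

text \<open>
  \<open>alt_comp n \<alpha> \<beta>\<close> is the alternating product with \<open>n\<close> factors, starting with \<open>\<alpha>\<close>. The product
  with no factors is the identity, so that \<open>alt_comp 1 \<alpha> \<beta> = \<alpha>\<close>.
\<close>

primrec alt_comp :: "nat \<Rightarrow> 'a rel \<Rightarrow> 'a rel \<Rightarrow> 'a rel" where
  "alt_comp 0 \<alpha> \<beta> = Id"
| "alt_comp (Suc n) \<alpha> \<beta> = \<alpha> O alt_comp n \<beta> \<alpha>"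

definition permutable_algebra :: "('f \<Rightarrow> nat) \<Rightarrow> nat \<Rightarrow> ('f, 'a) algebra \<Rightarrow> bool" where
  "permutable_algebra ar m A \<longleftrightarrow>
     (\<forall>\<alpha> \<beta>. congruence ar A \<alpha> \<longrightarrow> congruence ar A \<beta> \<longrightarrow> alt_comp m \<alpha> \<beta> = alt_comp m \<beta> \<alpha>)"

section \<open>Equational classes\<close>

datatype ('f, 'v) trm = Var 'v | Fun 'f "('f, 'v) trm list"

fun wf_trm :: "('f \<Rightarrow> nat) \<Rightarrow> ('f, 'v) trm \<Rightarrow> bool" where
  "wf_trm ar (Var x) \<longleftrightarrow> True"
| "wf_trm ar (Fun f ts) \<longleftrightarrow> length ts = ar f \<and> (\<forall>t\<in>set ts. wf_trm ar t)"

primrec trm_value :: "('f, 'a) algebra \<Rightarrow> ('v \<Rightarrow> 'a) \<Rightarrow> ('f, 'v) trm \<Rightarrow> 'a" where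
  "trm_value A \<rho> (Var x) = \<rho> x"
| "trm_value A \<rho> (Fun f ts) = oper A f (map (trm_value A \<rho>) ts)"

type_synonym 'f identity = "('f, nat) trm \<times> ('f, nat) trm"

definition identities :: "('f \<Rightarrow> nat) \<Rightarrow> 'f identity set \<Rightarrow> bool" where
  "identities ar E \<longleftrightarrow> (\<forall>(s, t)\<in>E. wf_trm ar s \<and> wf_trm ar t)"

definition satisfies :: "('f, 'a) algebra \<Rightarrow> 'f identity \<Rightarrow> bool" where
  "satisfies A e \<longleftrightarrow>
     (\<forall>\<rho>. range \<rho> \<subseteq> universe A \<longrightarrow> trm_value A \<rho> (fst e) = trm_value A \<rho> (snd e))"

definition in_variety :: "('f \<Rightarrow> nat) \<Rightarrow> 'f identity set \<Rightarrow> ('f, 'a) algebra \<Rightarrow> bool" where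
  "in_variety ar E A \<longleftrightarrow> is_algebra ar A \<and> (\<forall>e\<in>E. satisfies A e)"

text \<open>
  The variety axiomatized by \<open>E\<close> is \<open>m\<close>-permutable if all its algebras are. A formula cannot
  quantify over the types of their elements, so the definition mentions the algebras whose
  universe is a set of terms. These include, up to isomorphism, all countably generated algebras,
  and that suffices: by \<open>permutable_variety_all_algebras\<close> below, the members of the
  variety over every type are then \<open>m\<close>-permutable.
\<close>

definition permutable_variety :: "('f \<Rightarrow> nat) \<Rightarrow> nat \<Rightarrow> 'f identity set \<Rightarrow> bool" where
  "permutable_variety ar m E \<longleftrightarrow>
     (\<forall>A :: ('f, ('f, nat) trm) algebra. in_variety ar E A \<longrightarrow> permutable_algebra ar m A)"

lemma alt_comp_finite_support:
  assumes "(a, b) \<in> alt_comp n \<alpha> \<beta>"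
  shows "\<exists>F. finite F \<and> a \<in> F \<and> b \<in> F \<and> F \<subseteq> {a, b} \<union> Field \<alpha> \<union> Field \<beta> \<and>
           (a, b) \<in> alt_comp n (\<alpha> \<inter> F \<times> F) (\<beta> \<inter> F \<times> F)"
  using assms
proof (induction n arbitrary: a \<alpha> \<beta>)
  case 0
  then show ?case by (intro exI[of _ "{a}"]) auto
next
  case (Suc n)
  then obtain c where c: "(a, c) \<in> \<alpha>" "(c, b) \<in> alt_comp n \<beta> \<alpha>" by auto
  from Suc.IH[OF c(2)] obtain F where F: "finite F" "c \<in> F" "b \<in> F"
    "F \<subseteq> {c, b} \<union> Field \<beta> \<union> Field \<alpha>" "(c, b) \<in> alt_comp n (\<beta> \<inter> F \<times> F) (\<alpha> \<inter> F \<times> F)"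
    by blast
  have mono: "alt_comp k \<gamma> \<delta> \<subseteq> alt_comp k \<gamma>' \<delta>'"
    if "\<gamma> \<subseteq> \<gamma>'" "\<delta> \<subseteq> \<delta>'" for k and \<gamma> \<gamma>' \<delta> \<delta>' :: "'a rel"
    using that
  proof (induction k arbitrary: \<gamma> \<delta> \<gamma>' \<delta>')
    case (Suc k)
    then show ?case using relcomp_mono[OF Suc.prems(1) Suc.IH[OF Suc.prems(2,1)]] by simp
  qed simp
  let ?F = "insert a F"
  have "(c, b) \<in> alt_comp n (\<beta> \<inter> ?F \<times> ?F) (\<alpha> \<inter> ?F \<times> ?F)"
    using F(5) mono[of "\<beta> \<inter> F \<times> F" "\<beta> \<inter> ?F \<times> ?F" "\<alpha> \<inter> F \<times> F" "\<alpha> \<inter> ?F \<times> ?F" n] by blast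
  moreover have "c \<in> Field \<alpha>" using c(1) by (auto simp: Field_def)
  ultimately show ?case
    using F c(1) by (intro exI[of _ ?F]) auto
qed

lemma alt_comp_map:
  assumes "\<And>x y. (x, y) \<in> \<alpha> \<Longrightarrow> (h x, h y) \<in> \<alpha>'" "\<And>x y. (x, y) \<in> \<beta> \<Longrightarrow> (h x, h y) \<in> \<beta>'"
    and "(a, b) \<in> alt_comp n \<alpha> \<beta>"
  shows "(h a, h b) \<in> alt_comp n \<alpha>' \<beta>'"
  using assms
proof (induction n arbitrary: a \<alpha> \<beta> \<alpha>' \<beta>')
  case (Suc n)
  from Suc.prems(3) obtain c where "(a, c) \<in> \<alpha>" "(c, b) \<in> alt_comp n \<beta> \<alpha>" by auto
  moreover from this have "(h c, h b) \<in> alt_comp n \<beta>' \<alpha>'"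
    using Suc.IH[OF Suc.prems(2,1)] by blast
  ultimately show ?case using Suc.prems(1) by auto
qed auto

lemma trm_value_in_universe:
  assumes "is_algebra ar A" "range \<rho> \<subseteq> universe A" "wf_trm ar t"
  shows "trm_value A \<rho> t \<in> universe A"
  using assms(3)
proof (induction t)
  case (Fun f ts)
  then have "set (map (trm_value A \<rho>) ts) \<subseteq> universe A" by auto
  with Fun.prems assms(1) show ?case unfolding is_algebra_def by simp
qed (use assms in auto)

theorem permutable_variety_all_algebras:
  fixes A :: "('f, 'a) algebra"
  assumes E: "identities ar E" and P: "permutable_variety ar m E" and A: "in_variety ar E A"
  shows "permutable_algebra ar m A"
proof -
  have alg: "is_algebra ar A" using A by (simp add: in_variety_def)
  have main: "(a, b) \<in> alt_comp m \<beta> \<alpha>"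
    if \<alpha>: "congruence ar A \<alpha>" and \<beta>: "congruence ar A \<beta>" and ab: "(a, b) \<in> alt_comp m \<alpha> \<beta>"
    for \<alpha> \<beta> a b
  proof (cases "m = 0")
    case True
    with ab show ?thesis by simp
  next
    case False
    have sub: "\<alpha> \<subseteq> universe A \<times> universe A" "\<beta> \<subseteq> universe A \<times> universe A"
      using \<alpha> \<beta> by (auto simp: congruence_def compatible_def relation_on_def)
    have R: "b \<in> universe A" if "(a, b) \<in> alt_comp n \<alpha> \<beta>" "n \<noteq> 0"
      "\<alpha> \<subseteq> universe A \<times> universe A" "\<beta> \<subseteq> universe A \<times> universe A" for n a and \<alpha> \<beta> :: "'a rel"
      using that
    proof (induction n arbitrary: a \<alpha> \<beta>)
      case (Suc n)
      then show ?case by (cases "n = 0") auto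
    qed simp
    have "a \<in> universe A" using ab False sub by (cases m) auto
    moreover have "b \<in> universe A" using R[OF ab False sub] .
    moreover obtain F where F: "finite F" "a \<in> F" "b \<in> F"
      "F \<subseteq> {a, b} \<union> Field \<alpha> \<union> Field \<beta>" "(a, b) \<in> alt_comp m (\<alpha> \<inter> F \<times> F) (\<beta> \<inter> F \<times> F)"
      using alt_comp_finite_support[OF ab] by blast
    ultimately have FA: "F \<subseteq> universe A" using sub by (fastforce simp: Field_def)
    define \<rho> where "\<rho> = from_nat_into F"
    have \<rho>F: "range \<rho> = F" unfolding \<rho>_def
      using F(1,2) by (intro range_from_nat_into countable_finite) auto
    define ev where "ev = trm_value A \<rho>"
    define canon where "canon t = (SOME s. wf_trm ar s \<and> ev s = ev t)" for t
    have canon: "wf_trm ar (canon t)" "ev (canon t) = ev t" if "wf_trm ar t" for t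
      using someI[of "\<lambda>s. wf_trm ar s \<and> ev s = ev t" t] that unfolding canon_def by auto
    define C where "C = \<lparr>universe = canon ` {t. wf_trm ar t}, oper = (\<lambda>f ts. canon (Fun f ts))\<rparr>"
    have wfC: "wf_trm ar t" if "t \<in> universe C" for t
      using that canon unfolding C_def by auto
    have inj: "s = t" if st_C: "s \<in> universe C" "t \<in> universe C" and ev_eq: "ev s = ev t" for s t
    proof -
      obtain s' t' where st: "s = canon s'" "t = canon t'" "wf_trm ar s'" "wf_trm ar t'"
        using st_C unfolding C_def by auto
      then have "ev s' = ev t'" using ev_eq canon by simp
      then show ?thesis using st unfolding canon_def by simp
    qed
    have wfF: "wf_trm ar (Fun f ts)" if "length ts = ar f" "set ts \<subseteq> universe C" for f ts
      using that wfC by auto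
    have algC: "is_algebra ar C"
      unfolding is_algebra_def using wfF by (simp add: C_def)
    have hom: "ev (oper C f ts) = oper A f (map ev ts)"
      if "length ts = ar f" "set ts \<subseteq> universe C" for f ts
      using canon(2)[OF wfF[OF that]] by (simp add: C_def ev_def)
    have evA: "ev t \<in> universe A" if "t \<in> universe C" for t
      unfolding ev_def using trm_value_in_universe[OF alg _ wfC[OF that]] \<rho>F FA by simp
    have val: "ev (trm_value C \<sigma> t) = trm_value A (ev \<circ> \<sigma>) t"
      if \<sigma>: "range \<sigma> \<subseteq> universe C" and t: "wf_trm ar t" for \<sigma> and t :: "('f, nat) trm"
      using t
    proof (induction t)
      case (Fun f ts)
      have ts: "wf_trm ar t" if "t \<in> set ts" for t
        using Fun.prems that by auto
      have "set (map (trm_value C \<sigma>) ts) \<subseteq> universe C"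
        using trm_value_in_universe[OF algC \<sigma>] ts by auto
      moreover have "map ev (map (trm_value C \<sigma>) ts) = map (trm_value A (ev \<circ> \<sigma>)) ts"
        using Fun.IH ts by (simp add: comp_def)
      ultimately show ?case using hom[of "map (trm_value C \<sigma>) ts" f] Fun.prems
        by (simp add: comp_def cong: map_cong)
    qed simp
    have "satisfies C e" if e: "e \<in> E" for e
      unfolding satisfies_def
    proof (intro allI impI)
      fix \<sigma> :: "nat \<Rightarrow> ('f, nat) trm" assume \<sigma>: "range \<sigma> \<subseteq> universe C"
      have wf: "wf_trm ar (fst e)" "wf_trm ar (snd e)"
        using E e unfolding identities_def by auto
      have "range (ev \<circ> \<sigma>) \<subseteq> universe A" using \<sigma> evA by auto
      then have "trm_value A (ev \<circ> \<sigma>) (fst e) = trm_value A (ev \<circ> \<sigma>) (snd e)"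
        using A e unfolding in_variety_def satisfies_def by blast
      then show "trm_value C \<sigma> (fst e) = trm_value C \<sigma> (snd e)"
        using inj trm_value_in_universe[OF algC \<sigma>] wf val[OF \<sigma>] by metis
    qed
    with algC have C: "in_variety ar E C" by (simp add: in_variety_def)
    define pb where "pb \<theta> = {(s, t). s \<in> universe C \<and> t \<in> universe C \<and> (ev s, ev t) \<in> \<theta>}" for \<theta>
    have cong: "congruence ar C (pb \<theta>)" if \<theta>: "congruence ar A \<theta>" for \<theta>
    proof -
      have eq: "equiv (universe A) \<theta>" and comp: "compatible ar A \<theta>"
        using \<theta> by (auto simp: congruence_def)
      have "equiv (universe C) (pb \<theta>)"
        using eq evA unfolding equiv_def refl_on_def sym_def trans_def pb_def by blast
      moreover have "(oper C f xs, oper C f ys) \<in> pb \<theta>"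
        if len: "length xs = ar f" "length ys = ar f"
          and xy: "\<forall>i<ar f. (xs ! i, ys ! i) \<in> pb \<theta>" for f xs ys
      proof -
        have s: "set xs \<subseteq> universe C" "set ys \<subseteq> universe C"
          using len xy by (auto simp: in_set_conv_nth pb_def)
        have "(oper A f (map ev xs), oper A f (map ev ys)) \<in> \<theta>"
          using comp len xy unfolding compatible_def by (auto simp: pb_def)
        moreover have "oper C f xs \<in> universe C" "oper C f ys \<in> universe C"
          using algC len s unfolding is_algebra_def by blast+
        ultimately show ?thesis using hom len s by (simp add: pb_def)
      qed
      ultimately show ?thesis
        unfolding congruence_def compatible_def relation_on_def by (auto simp: pb_def)
    qed
    define g where "g x = canon (Var (SOME n. \<rho> n = x))" for x
    have g: "g x \<in> universe C" "ev (g x) = x" if "x \<in> F" for x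
    proof -
      have "\<exists>n. \<rho> n = x" using that \<rho>F by auto
      then have "\<rho> (SOME n. \<rho> n = x) = x" by (rule someI_ex)
      then show "ev (g x) = x" "g x \<in> universe C"
        using canon by (auto simp: g_def C_def ev_def)
    qed
    have "(g a, g b) \<in> alt_comp m (pb \<alpha>) (pb \<beta>)"
      by (rule alt_comp_map[OF _ _ F(5)]) (use g in \<open>auto simp: pb_def\<close>)
    also have "alt_comp m (pb \<alpha>) (pb \<beta>) = alt_comp m (pb \<beta>) (pb \<alpha>)"
      using P C cong[OF \<alpha>] cong[OF \<beta>] unfolding permutable_variety_def permutable_algebra_def
      by blast
    finally have "(ev (g a), ev (g b)) \<in> alt_comp m \<beta> \<alpha>"
      by (rule alt_comp_map[rotated 2]) (auto simp: pb_def)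
    then show ?thesis using g F by simp
  qed
  then show ?thesis unfolding permutable_algebra_def by auto
qed

section \<open>Nested relational products\<close>

text \<open>
  \<open>nested R S T i k\<close> is the expression that starts at index \<open>i\<close> and has \<open>k\<close> levels of nesting:
  \<open>R\<^sub>i(S\<^bsub>i+1\<^esub> \<circ> R\<^bsub>i+1\<^esub>(\<dots> (S\<^bsub>i+k\<^esub> \<circ> R\<^bsub>i+k\<^esub> \<circ> T\<^bsub>i+k\<^esub>) \<dots>) \<circ> T\<^bsub>i+1\<^esub>)\<close>.
\<close>

primrec nested ::
  "(nat \<Rightarrow> 'a rel) \<Rightarrow> (nat \<Rightarrow> 'a rel) \<Rightarrow> (nat \<Rightarrow> 'a rel) \<Rightarrow> nat \<Rightarrow> nat \<Rightarrow> 'a rel" where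
  "nested R S T i 0 = R i"
| "nested R S T i (Suc k) = R i \<inter> (S (Suc i) O nested R S T (Suc i) k O T (Suc i))"

text \<open>The outermost and the innermost relation, \<open>R\<^sub>0\<close> and \<open>R\<^sub>m\<close>, are left unchanged.\<close>

definition R_prime ::
  "('f \<Rightarrow> nat) \<Rightarrow> ('f, 'a) algebra \<Rightarrow> nat \<Rightarrow> (nat \<Rightarrow> 'a rel) \<Rightarrow> nat \<Rightarrow> 'a rel" where
  "R_prime ar A m R i =
     (if 1 \<le> i \<and> i \<le> m - 1 then compat_closure ar A (R (i - 1) \<union> R i \<union> R (i + 1)) else R i)"

definition S_prime ::
  "('f \<Rightarrow> nat) \<Rightarrow> ('f, 'a) algebra \<Rightarrow> nat \<Rightarrow> (nat \<Rightarrow> 'a rel) \<Rightarrow> nat \<Rightarrow> 'a rel" where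
  "S_prime ar A m S i =
     (if i = 1 then compat_closure ar A (S 2)
      else if i = m then compat_closure ar A (S (m - 1))
      else compat_closure ar A (S (i - 1)) O compat_closure ar A (S (i + 1)))"

definition T_prime ::
  "('f \<Rightarrow> nat) \<Rightarrow> ('f, 'a) algebra \<Rightarrow> nat \<Rightarrow> (nat \<Rightarrow> 'a rel) \<Rightarrow> nat \<Rightarrow> 'a rel" where
  "T_prime ar A m T i =
     (if i = 1 then compat_closure ar A (T 2)
      else if i = m then compat_closure ar A (T (m - 1))
      else compat_closure ar A (T (i + 1)) O compat_closure ar A (T (i - 1)))"

end

theory Submission
  imports Defs
begin

text \<open>
  A pair \<open>(a 0, b 0)\<close> in the smaller expression comes with a ladder: a chain \<open>a 0, \<dots>, a m\<close> whose
  steps lie in the \<open>S i\<close>, a chain \<open>b m, \<dots>, b 0\<close> whose steps lie in the \<open>T i\<close>, and rungs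
  \<open>(a i, b i) \<in> R i\<close>. An \<open>m\<close>-permutable variety has Hagemann--Mitschke operations
  \<open>p 0, \<dots>, p m\<close>, satisfying \<open>p i x x z = p (i + 1) x z z\<close>, where \<open>p 0\<close> and \<open>p m\<close> are here normalized to
  be the projection to the middle argument. The ladder required by the larger expression is
  obtained by replacing \<open>a i\<close> with \<open>p i (a (i - 1)) (a i) (a (i + 1))\<close>, and likewise for \<open>b\<close>. The two
  ends of the chains do not move, every other rung now lies in the closure of the union of three
  neighbouring \<open>R\<close>'s, and the step from \<open>i\<close> to \<open>i + 1\<close> passes through the common value
  \<open>p i (a i) (a i) (a (i + 1)) = p (i + 1) (a i) (a (i + 1)) (a (i + 1))\<close>: the first half changes only
  the left argument, along \<open>S i\<close>, and the second half only the right one, along \<open>S (i + 2)\<close>.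
  In the first and the last step one of the two halves is void.

  The operations \<open>p i\<close> are found inside \<open>A\<close>, with no free algebra. The functions from
  assignments \<open>nat \<Rightarrow> 'a\<close> to the universe that preserve all compatible relations of \<open>A\<close> form a
  subalgebra of a power of \<open>A\<close>, hence a member of the variety. In it,
  \<open>m\<close>-permutability is applied to the two congruences of agreeing on all assignments that
  identify the variables \<open>2k, 2k + 1\<close>, respectively \<open>2k + 1, 2k + 2\<close>. The projections to the variables
  \<open>0, 1, \<dots>, m\<close> form a chain alternating between them, and the elements of a chain alternating in the
  other order give the \<open>p i\<close> by suitable identification of variables.
\<close>

section \<open>Alternating and nested products as chains\<close>

lemma alt_comp_iff_chain:
  "(a, b) \<in> alt_comp n \<alpha> \<beta> \<longleftrightarrow>
     (\<exists>q. q 0 = a \<and> q n = b \<and> (\<forall>i<n. (q i, q (Suc i)) \<in> (if even i then \<alpha> else \<beta>)))"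
proof (induction n arbitrary: a \<alpha> \<beta>)
  case 0
  then show ?case by (auto intro: exI[of _ "\<lambda>_. b"])
next
  case (Suc n)
  show ?case
  proof
    assume "(a, b) \<in> alt_comp (Suc n) \<alpha> \<beta>"
    then obtain c where c: "(a, c) \<in> \<alpha>" "(c, b) \<in> alt_comp n \<beta> \<alpha>" by auto
    then obtain q where q: "q 0 = c" "q n = b"
      "\<forall>i<n. (q i, q (Suc i)) \<in> (if even i then \<beta> else \<alpha>)"
      using Suc.IH by blast
    have "\<forall>i<Suc n. (case_nat a q i, case_nat a q (Suc i)) \<in> (if even i then \<alpha> else \<beta>)"
      using q c(1) by (auto split: nat.split)
    with q(2) show "\<exists>q. q 0 = a \<and> q (Suc n) = b \<and>
        (\<forall>i<Suc n. (q i, q (Suc i)) \<in> (if even i then \<alpha> else \<beta>))"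
      by (intro exI[of _ "case_nat a q"]) simp
  next
    assume "\<exists>q. q 0 = a \<and> q (Suc n) = b \<and>
        (\<forall>i<Suc n. (q i, q (Suc i)) \<in> (if even i then \<alpha> else \<beta>))"
    then obtain q where q: "q 0 = a" "q (Suc n) = b"
      "\<And>i. i < Suc n \<Longrightarrow> (q i, q (Suc i)) \<in> (if even i then \<alpha> else \<beta>)" by blast
    have "(q (Suc i), q (Suc (Suc i))) \<in> (if even i then \<beta> else \<alpha>)" if "i < n" for i
      using q(3)[of "Suc i"] that by (auto split: if_splits)
    then have "(q (Suc 0), b) \<in> alt_comp n \<beta> \<alpha>"
      unfolding Suc.IH using q(2) by (intro exI[of _ "\<lambda>i. q (Suc i)"]) auto
    moreover have "(a, q (Suc 0)) \<in> \<alpha>" using q(1) q(3)[of 0] by simp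
    ultimately show "(a, b) \<in> alt_comp (Suc n) \<alpha> \<beta>" by auto
  qed
qed

text \<open>
  A witness for membership in a nested product is a ladder: the \<open>S\<close>'s lead down one side, the
  \<open>T\<close>'s back up the other, and each intersection with an \<open>R\<close> puts in a rung.
\<close>

lemma nested_iff_ladder:
  "(x, y) \<in> nested R S T i k \<longleftrightarrow>
     (\<exists>a b. a i = x \<and> b i = y \<and> (\<forall>j. i \<le> j \<and> j \<le> i + k \<longrightarrow> (a j, b j) \<in> R j) \<and>
       (\<forall>j. i \<le> j \<and> j < i + k \<longrightarrow>
          (a j, a (Suc j)) \<in> S (Suc j) \<and> (b (Suc j), b j) \<in> T (Suc j)))"
proof (induction k arbitrary: i x y)
  case 0
  have j: "j = i" if "i \<le> j \<and> j \<le> i + 0" for j using that by simp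
  show ?case (is "_ \<longleftrightarrow> ?ladder")
  proof
    assume "(x, y) \<in> nested R S T i 0"
    then show ?ladder using j by (intro exI[of _ "\<lambda>_. x"] exI[of _ "\<lambda>_. y"]) auto
  qed auto
next
  case (Suc k)
  show ?case (is "_ \<longleftrightarrow> ?ladder")
  proof
    assume "(x, y) \<in> nested R S T i (Suc k)"
    then obtain x' y' where xy: "(x, y) \<in> R i" "(x, x') \<in> S (Suc i)" "(y', y) \<in> T (Suc i)"
      "(x', y') \<in> nested R S T (Suc i) k" by auto
    then obtain a b where ab: "a (Suc i) = x'" "b (Suc i) = y'"
      "\<And>j. Suc i \<le> j \<Longrightarrow> j \<le> Suc i + k \<Longrightarrow> (a j, b j) \<in> R j"
      "\<And>j. Suc i \<le> j \<Longrightarrow> j < Suc i + k \<Longrightarrow>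
         (a j, a (Suc j)) \<in> S (Suc j) \<and> (b (Suc j), b j) \<in> T (Suc j)"
      unfolding Suc.IH by blast
    have "((a(i := x)) j, (b(i := y)) j) \<in> R j" if "i \<le> j" "j \<le> i + Suc k" for j
      using that xy(1) ab(3)[of j] by auto
    moreover have "((a(i := x)) j, (a(i := x)) (Suc j)) \<in> S (Suc j) \<and>
        ((b(i := y)) (Suc j), (b(i := y)) j) \<in> T (Suc j)" if "i \<le> j" "j < i + Suc k" for j
      using that xy(2,3) ab(1,2) ab(4)[of j] by auto
    ultimately show ?ladder by (intro exI[of _ "a(i := x)"] exI[of _ "b(i := y)"]) simp
  next
    assume ?ladder
    then obtain a b where ab: "a i = x" "b i = y"
      "\<And>j. i \<le> j \<Longrightarrow> j \<le> i + Suc k \<Longrightarrow> (a j, b j) \<in> R j"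
      "\<And>j. i \<le> j \<Longrightarrow> j < i + Suc k \<Longrightarrow>
         (a j, a (Suc j)) \<in> S (Suc j) \<and> (b (Suc j), b j) \<in> T (Suc j)" by blast
    have "(a (Suc i), b (Suc i)) \<in> nested R S T (Suc i) k"
      unfolding Suc.IH by (intro exI[of _ a] exI[of _ b]) (auto intro!: ab(3) simp: ab(4))
    then show "(x, y) \<in> nested R S T i (Suc k)"
      using ab(1,2) ab(3)[of i] ab(4)[of i] by auto
  qed
qed

section \<open>The algebra of relation-preserving functions\<close>

abbreviation assignments :: "('f, 'a) algebra \<Rightarrow> (nat \<Rightarrow> 'a) set" where
  "assignments A \<equiv> {\<rho>. range \<rho> \<subseteq> universe A}"

text \<open>
  Preserving compatible relations is all that is ever used of a term operation, so these
  functions can play the role of the free algebra over infinitely many generators. The fixed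
  value off the assignments into the universe makes equality of functions mean equality on
  those assignments; without it the identities could fail.
\<close>

definition preserving_algebra ::
  "('f \<Rightarrow> nat) \<Rightarrow> ('f, 'a) algebra \<Rightarrow> ('f, (nat \<Rightarrow> 'a) \<Rightarrow> 'a) algebra" where
  "preserving_algebra ar A =
     \<lparr>universe = {q. (\<forall>X \<rho> \<sigma>. compatible ar A X \<longrightarrow> (\<forall>i. (\<rho> i, \<sigma> i) \<in> X) \<longrightarrow> (q \<rho>, q \<sigma>) \<in> X) \<and>
                     (\<forall>\<rho>. \<rho> \<notin> assignments A \<longrightarrow> q \<rho> = undefined)},
      oper = (\<lambda>f qs \<rho>. if \<rho> \<in> assignments A then oper A f (map (\<lambda>q. q \<rho>) qs) else undefined)\<rparr>"

lemma compatible_universe: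
  assumes "is_algebra ar A"
  shows "compatible ar A (universe A \<times> universe A)"
  using assms unfolding compatible_def is_algebra_def relation_on_def
  by (auto simp: in_set_conv_nth subset_iff)

lemma compatible_assignments:
  assumes "compatible ar A X" and "\<forall>i. (\<rho> i, \<sigma> i) \<in> X"
  shows "\<rho> \<in> assignments A \<and> \<sigma> \<in> assignments A"
  using assms unfolding compatible_def relation_on_def by blast

lemma preserving_algebraD:
  assumes "q \<in> universe (preserving_algebra ar A)"
  shows "compatible ar A X \<Longrightarrow> (\<And>i. (\<rho> i, \<sigma> i) \<in> X) \<Longrightarrow> (q \<rho>, q \<sigma>) \<in> X"
    and "\<rho> \<notin> assignments A \<Longrightarrow> q \<rho> = undefined"
  using assms unfolding preserving_algebra_def by auto

lemma is_algebra_preserving_algebra: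
  "is_algebra ar (preserving_algebra ar A)"
  unfolding is_algebra_def
proof (intro allI impI)
  fix f qs
  assume len: "length qs = ar f" and qs: "set qs \<subseteq> universe (preserving_algebra ar A)"
  have "(oper A f (map (\<lambda>q. q \<rho>) qs), oper A f (map (\<lambda>q. q \<sigma>) qs)) \<in> X"
    if X: "compatible ar A X" and \<rho>\<sigma>: "\<forall>i. (\<rho> i, \<sigma> i) \<in> X" for X \<rho> \<sigma>
  proof -
    have "(q \<rho>, q \<sigma>) \<in> X" if "q \<in> set qs" for q
      using preserving_algebraD(1)[OF _ X] \<rho>\<sigma> qs that by blast
    then show ?thesis using X len unfolding compatible_def by simp
  qed
  then show "oper (preserving_algebra ar A) f qs \<in> universe (preserving_algebra ar A)"
    using compatible_assignments[of ar A] by (simp add: preserving_algebra_def)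
qed

lemma preserving_algebra_in_variety:
  assumes "in_variety ar E A"
  shows "in_variety ar E (preserving_algebra ar A)"
  unfolding in_variety_def
proof (intro conjI ballI)
  let ?C = "preserving_algebra ar A"
  have alg: "is_algebra ar A" using assms by (simp add: in_variety_def)
  show "is_algebra ar ?C" by (rule is_algebra_preserving_algebra)
  fix e assume e: "e \<in> E"
  show "satisfies ?C e"
    unfolding satisfies_def
  proof (intro allI impI ext)
    fix \<tau> :: "nat \<Rightarrow> (nat \<Rightarrow> 'b) \<Rightarrow> 'b" and \<rho>
    assume \<tau>: "range \<tau> \<subseteq> universe ?C"
    have inside: "trm_value ?C \<tau> t \<rho> = trm_value A (\<lambda>v. \<tau> v \<rho>) t"
      if "\<rho> \<in> assignments A" for t
    proof (induction t)
      case (Fun f ts)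
      then show ?case using that
        by (simp add: preserving_algebra_def comp_def cong: map_cong)
    qed simp
    have outside: "trm_value ?C \<tau> t \<rho> = undefined" if "\<rho> \<notin> assignments A" for t
    proof (cases t)
      case (Var v)
      have "\<tau> v \<in> universe ?C" using \<tau> by blast
      then show ?thesis using preserving_algebraD(2) that Var by simp
    next
      case (Fun f ts)
      then show ?thesis using that by (simp add: preserving_algebra_def)
    qed
    show "trm_value ?C \<tau> (fst e) \<rho> = trm_value ?C \<tau> (snd e) \<rho>"
    proof (cases "\<rho> \<in> assignments A")
      case True
      have "(\<tau> v \<rho>, \<tau> v \<rho>) \<in> universe A \<times> universe A" for v
        by (rule preserving_algebraD(1)[OF _ compatible_universe[OF alg]]) (use \<tau> True in auto)
      then have "range (\<lambda>v. \<tau> v \<rho>) \<subseteq> universe A" by auto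
      then show ?thesis
        using assms e unfolding inside[OF True] in_variety_def satisfies_def by blast
    next
      case False
      then show ?thesis by (simp only: outside[OF False])
    qed
  qed
qed

definition agreement ::
  "('f \<Rightarrow> nat) \<Rightarrow> ('f, 'a) algebra \<Rightarrow> (nat \<Rightarrow> 'a) set \<Rightarrow> ((nat \<Rightarrow> 'a) \<Rightarrow> 'a) rel" where
  "agreement ar A D = {(q, r). q \<in> universe (preserving_algebra ar A) \<and>
     r \<in> universe (preserving_algebra ar A) \<and> (\<forall>\<rho>\<in>D. q \<rho> = r \<rho>)}"

lemma congruence_agreement:
  "congruence ar (preserving_algebra ar A) (agreement ar A D)"
proof -
  let ?C = "preserving_algebra ar A"
  have "equiv (universe ?C) (agreement ar A D)"
    unfolding equiv_def refl_on_def sym_def trans_def agreement_def by auto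
  moreover have "(oper ?C f qs, oper ?C f rs) \<in> agreement ar A D"
    if len: "length qs = ar f" "length rs = ar f"
      and qr: "\<forall>i<ar f. (qs ! i, rs ! i) \<in> agreement ar A D" for f qs rs
  proof -
    have "set qs \<subseteq> universe ?C" "set rs \<subseteq> universe ?C"
      using len qr by (auto simp: in_set_conv_nth agreement_def)
    then have "oper ?C f qs \<in> universe ?C" "oper ?C f rs \<in> universe ?C"
      using is_algebra_preserving_algebra[of ar A] len unfolding is_algebra_def by simp_all
    moreover have "map (\<lambda>q. q \<rho>) qs = map (\<lambda>q. q \<rho>) rs" if "\<rho> \<in> D" for \<rho>
      using len qr that by (auto simp: list_eq_iff_nth_eq agreement_def)
    then have "\<forall>\<rho>\<in>D. oper ?C f qs \<rho> = oper ?C f rs \<rho>"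
      by (simp add: preserving_algebra_def)
    ultimately show ?thesis unfolding agreement_def by simp
  qed
  moreover have "relation_on ?C (agreement ar A D)"
    unfolding relation_on_def agreement_def by blast
  ultimately show ?thesis
    unfolding congruence_def compatible_def by blast
qed

section \<open>Hagemann--Mitschke operations\<close>

text \<open>
  Each \<open>p i\<close> arises from a function \<open>q i\<close> of countably many variables by substituting \<open>x\<close> for the
  variables before \<open>i\<close>, \<open>y\<close> for \<open>i\<close> and \<open>z\<close> for those after \<open>i\<close>. Then
  \<open>p i x x z\<close> and \<open>p (i + 1) x z z\<close> are the values of \<open>q i\<close> and \<open>q (i + 1)\<close> at one and the same
  assignment, which jumps only between \<open>i\<close> and \<open>i + 1\<close>. It therefore identifies all pairs of
  adjacent variables that start at an index of the parity opposite to \<open>i\<close>, and on such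
  assignments \<open>q i\<close> and \<open>q (i + 1)\<close> agree.
\<close>

lemma hagemann_mitschke_operations:
  fixes A :: "('f, 'a) algebra"
  assumes E: "identities ar E" and P: "permutable_variety ar m E" and A: "in_variety ar E A"
  obtains p :: "nat \<Rightarrow> 'a \<Rightarrow> 'a \<Rightarrow> 'a \<Rightarrow> 'a" where
    "\<And>i X x x' y y' z z'. i \<le> m \<Longrightarrow> compatible ar A X \<Longrightarrow>
       (x, x') \<in> X \<Longrightarrow> (y, y') \<in> X \<Longrightarrow> (z, z') \<in> X \<Longrightarrow> (p i x y z, p i x' y' z') \<in> X"
    and "\<And>x y z. {x, y, z} \<subseteq> universe A \<Longrightarrow> p 0 x y z = y"
    and "\<And>x y z. {x, y, z} \<subseteq> universe A \<Longrightarrow> p m x y z = y"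
    and "\<And>i x z. i < m \<Longrightarrow> {x, z} \<subseteq> universe A \<Longrightarrow> p i x x z = p (Suc i) x z z"
proof -
  let ?C = "preserving_algebra ar A"
  define D where
    "D b = {\<rho> \<in> assignments A. \<forall>i. even i = b \<longrightarrow> \<rho> i = \<rho> (Suc i)}" for b
  define \<theta> where "\<theta> b = agreement ar A (D b)" for b
  define proj where
    "proj i = (\<lambda>\<rho>. if \<rho> \<in> assignments A then \<rho> i else undefined)" for i :: nat
  have proj: "proj i \<in> universe ?C" for i
    using compatible_assignments[of ar A] by (simp add: preserving_algebra_def proj_def)
  have step: "(proj i, proj (Suc i)) \<in> (if even i then \<theta> True else \<theta> False)" for i
    using proj by (auto simp: \<theta>_def agreement_def D_def) (auto simp: proj_def)
  have "(proj 0, proj m) \<in> alt_comp m (\<theta> True) (\<theta> False)"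
    unfolding alt_comp_iff_chain using step by (intro exI[of _ proj]) simp
  also have "alt_comp m (\<theta> True) (\<theta> False) = alt_comp m (\<theta> False) (\<theta> True)"
    using permutable_variety_all_algebras[OF E P preserving_algebra_in_variety[OF A]]
      congruence_agreement unfolding permutable_algebra_def \<theta>_def by blast
  finally obtain q where q: "q 0 = proj 0" "q m = proj m"
    "\<And>i. i < m \<Longrightarrow> (q i, q (Suc i)) \<in> \<theta> (odd i)"
    unfolding alt_comp_iff_chain by (auto split: if_splits) (metis (full_types))
  have q_mem: "q i \<in> universe ?C" if "i \<le> m" for i
  proof (cases "i = m")
    case True
    then show ?thesis using proj q(2) by simp
  next
    case False
    with that show ?thesis using q(3)[of i] unfolding \<theta>_def agreement_def by auto
  qed
  define p where
    "p i x y z = q i (\<lambda>j. if j < i then x else if j = i then y else z)" for i x y z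
  show thesis
  proof (rule that[of p])
    fix i X x x' y y' z z'
    assume "i \<le> m" "compatible ar A X" "(x, x') \<in> X" "(y, y') \<in> X" "(z, z') \<in> X"
    then show "(p i x y z, p i x' y' z') \<in> X"
      unfolding p_def by (intro preserving_algebraD(1)[OF q_mem]) auto
  next
    fix x y z assume "{x, y, z} \<subseteq> universe A"
    then show "p 0 x y z = y" and "p m x y z = y"
      by (auto simp: p_def q(1,2) proj_def)
  next
    fix i x z assume i: "i < m" and xz: "{x, z} \<subseteq> universe A"
    let ?\<rho> = "\<lambda>j. if j \<le> i then x else z"
    have \<rho>: "?\<rho> \<in> D (odd i)"
      using xz by (auto simp: D_def not_less_eq_eq le_Suc_eq)
    have "p i x x z = q i ?\<rho>" unfolding p_def by (rule arg_cong[of _ _ "q i"]) auto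
    also have "\<dots> = q (Suc i) ?\<rho>"
      using q(3)[OF i] \<rho> unfolding \<theta>_def agreement_def by blast
    also have "\<dots> = p (Suc i) x z z"
      unfolding p_def by (rule arg_cong[of _ _ "q (Suc i)"]) auto
    finally show "p i x x z = p (Suc i) x z z" .
  qed
qed

section \<open>The inclusion of nested products\<close>

lemma reflexive_compat_closure:
  assumes "is_algebra ar A" and "reflexive_on A X"
  shows "compatible ar A (compat_closure ar A X)"
    and "(x, y) \<in> X \<Longrightarrow> (x, y) \<in> compat_closure ar A X"
    and "x \<in> universe A \<Longrightarrow> (x, x) \<in> compat_closure ar A X"
  using compat_closure_least(1,2)[OF assms(1), of X] assms(2)
  unfolding reflexive_on_def refl_on_def by blast+

theorem proposition5:
  fixes ar :: "'f \<Rightarrow> nat" and E :: "'f identity set" and A :: "('f, 'a) algebra"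
    and m :: nat and R S T :: "nat \<Rightarrow> 'a rel"
  assumes "m \<ge> 2"
    and "identities ar E" and "permutable_variety ar m E" and "in_variety ar E A"
    and "\<And>i. i \<le> m \<Longrightarrow> relation_on A (R i)"
    and "\<And>i. 1 \<le> i \<Longrightarrow> i \<le> m \<Longrightarrow> reflexive_on A (S i)"
    and "\<And>i. 1 \<le> i \<Longrightarrow> i \<le> m \<Longrightarrow> reflexive_on A (T i)"
  shows "nested R S T 0 m
           \<subseteq> nested (R_prime ar A m R) (S_prime ar A m S) (T_prime ar A m T) 0 m"
proof (rule subrelI)
  fix x y assume "(x, y) \<in> nested R S T 0 m"
  then obtain a b where ab: "a 0 = x" "b 0 = y"
    and rung: "\<And>j. j \<le> m \<Longrightarrow> (a j, b j) \<in> R j"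
    and S: "\<And>j. j < m \<Longrightarrow> (a j, a (Suc j)) \<in> S (Suc j)"
    and T: "\<And>j. j < m \<Longrightarrow> (b (Suc j), b j) \<in> T (Suc j)"
    unfolding nested_iff_ladder by auto
  have alg: "is_algebra ar A" using assms(4) by (simp add: in_variety_def)
  have mem: "a j \<in> universe A" "b j \<in> universe A" if "j \<le> m" for j
    using rung[OF that] assms(5)[OF that] unfolding relation_on_def by auto
  obtain p where pres: "\<And>i X x x' y y' z z'. i \<le> m \<Longrightarrow> compatible ar A X \<Longrightarrow>
       (x, x') \<in> X \<Longrightarrow> (y, y') \<in> X \<Longrightarrow> (z, z') \<in> X \<Longrightarrow> (p i x y z, p i x' y' z') \<in> X"
    and p0: "\<And>x y z. {x, y, z} \<subseteq> universe A \<Longrightarrow> p 0 x y z = y"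
    and pm: "\<And>x y z. {x, y, z} \<subseteq> universe A \<Longrightarrow> p m x y z = y"
    and link: "\<And>i x z. i < m \<Longrightarrow> {x, z} \<subseteq> universe A \<Longrightarrow> p i x x z = p (Suc i) x z z"
    by (rule hagemann_mitschke_operations[OF assms(2-4)], rule that)
  \<comment> \<open>At the two ends one neighbour is missing; there the middle argument is returned
    outright, as \<open>p 0\<close> and \<open>p m\<close> would do.\<close>
  define c where "c u i = (if i = 0 \<or> i = m then u i else p i (u (i - 1)) (u i) (u (i + 1)))"
    for u :: "nat \<Rightarrow> 'a" and i
  \<comment> \<open>The value through which the step from \<open>c u i\<close> to \<open>c u (Suc i)\<close> passes.\<close>
  define mid where "mid u i = p i (u i) (u i) (u (Suc i))" for u :: "nat \<Rightarrow> 'a" and i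
  have first: "mid u 0 = u 0" and last: "mid u (m - 1) = u m"
    if "\<And>j. j \<le> m \<Longrightarrow> u j \<in> universe A" for u
    using p0[of "u 0" "u 0" "u 1"] link[of "m - 1" "u (m - 1)" "u m"]
      pm[of "u (m - 1)" "u m" "u m"] that assms(1)
    unfolding mid_def by auto
  define cl where "cl = compat_closure ar A"
  note cl = reflexive_compat_closure[OF alg, folded cl_def]
  have S_step: "compatible ar A (cl (S (Suc j)))" "(a j, a (Suc j)) \<in> cl (S (Suc j))"
      "\<And>i. i \<le> m \<Longrightarrow> (a i, a i) \<in> cl (S (Suc j))"
    and T_step: "compatible ar A (cl (T (Suc j)))" "(b (Suc j), b j) \<in> cl (T (Suc j))"
      "\<And>i. i \<le> m \<Longrightarrow> (b i, b i) \<in> cl (T (Suc j))" if "j < m" for j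
    using cl[OF assms(6)[of "Suc j"]] cl[OF assms(7)[of "Suc j"]] S[OF that] T[OF that] mem that
    by simp_all
  have left: "(c a i, mid a i) \<in> cl (S i)" "(mid b i, c b i) \<in> cl (T i)"
    if i: "0 < i" "i < m" for i
  proof -
    obtain j where j: "i = Suc j" using i(1) gr0_implies_Suc by blast
    show "(c a i, mid a i) \<in> cl (S i)" "(mid b i, c b i) \<in> cl (T i)"
      using i S_step[of j] T_step[of j] unfolding j c_def mid_def by (simp_all add: pres)
  qed
  have right: "(mid a i, c a (Suc i)) \<in> cl (S (Suc (Suc i)))"
      "(c b (Suc i), mid b i) \<in> cl (T (Suc (Suc i)))" if i: "Suc i < m" for i
  proof -
    have "mid u i = p (Suc i) (u i) (u (Suc i)) (u (Suc i))"
      if "u i \<in> universe A" "u (Suc i) \<in> universe A" for u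
      using link[of i "u i" "u (Suc i)"] i that by (simp add: mid_def)
    then show "(mid a i, c a (Suc i)) \<in> cl (S (Suc (Suc i)))"
      "(c b (Suc i), mid b i) \<in> cl (T (Suc (Suc i)))"
      using i S_step[of "Suc i"] T_step[of "Suc i"] mem by (simp_all add: c_def pres)
  qed
  have ends: "c u 0 = u 0" "c u m = u m" for u by (simp_all add: c_def)
  have "(c a j, c b j) \<in> R_prime ar A m R j" if "j \<le> m" for j
  proof (cases "j = 0 \<or> j = m")
    case True
    then show ?thesis using rung[OF that] assms(1) by (auto simp: c_def R_prime_def)
  next
    case False
    with that have j: "0 < j" "j < m" by auto
    let ?X = "R (j - 1) \<union> R j \<union> R (j + 1)"
    have "relation_on A ?X"
      using assms(5)[of "j - 1"] assms(5)[of j] assms(5)[of "j + 1"] j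
      unfolding relation_on_def by auto
    note X = compat_closure_least(1,2)[OF alg this]
    have "(a i, b i) \<in> compat_closure ar A ?X" if "i \<in> {j - 1, j, j + 1}" for i
      using rung[of i] that j X(2) by auto
    then have "(c a j, c b j) \<in> compat_closure ar A ?X"
      using j pres[OF _ X(1)] by (simp add: c_def)
    moreover have "1 \<le> j \<and> j \<le> m - 1" using j by linarith
    ultimately show ?thesis unfolding R_prime_def by simp
  qed
  moreover have "(c a j, c a (Suc j)) \<in> S_prime ar A m S (Suc j) \<and>
      (c b (Suc j), c b j) \<in> T_prime ar A m T (Suc j)" if j: "j < m" for j
  proof -
    consider "j = 0" | "0 < j" "Suc j = m" | "0 < j" "Suc j < m" using j by linarith
    then show ?thesis
    proof cases
      case 1
      then show ?thesis
        using right[of 0] first[of a] first[of b] mem ends(1) assms(1)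
        by (simp add: S_prime_def T_prime_def cl_def numeral_2_eq_2)
    next
      case 2
      then have "j = m - 1" by simp
      with 2 show ?thesis
        using left[of j] last[of a] last[of b] mem ends(2)
        by (auto simp: S_prime_def T_prime_def cl_def)
    next
      case 3
      then show ?thesis
        using left[of j] right[of j]
        by (auto simp: S_prime_def T_prime_def cl_def)
    qed
  qed
  ultimately show "(x, y) \<in> nested (R_prime ar A m R) (S_prime ar A m S) (T_prime ar A m T) 0 m"
    unfolding nested_iff_ladder using ab ends(1)
    by (intro exI[of _ "c a"] exI[of _ "c b"]) simp
qed

end
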